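(* Let $n$ be a positive integer and $X=\{x_1,\ldots,x_n\}$. For every subgroup $H$ of $S_n$ there is a partition of the set $X^{n-1}$ such that $H$ is exactly the set of elements of $S_n$ whose action on $X^{n-1}$ preserves the partition.
   Context: $S_n$ acts on $X$ by permuting its elements, $\sigma x_i=x_{\sigma(i)}$, and on $X^{n-1}$ (the set of $(n-1)$-tuples of elements of $X$) by acting on each entry separately. A partition of $X^{n-1}$ is given by a labeling of its elements; an element of $S_n$ preserves the partition if it sends every tuple to a tuple with the same label, i.e. it maps each block of the partition to itself. *)

theory Defs
  imports "HOL-Algebra.Sym_Groups" "HOL-Library.Disjoint_Sets"
begin

text \<open>
  The elements of \<open>S\<^sub>n\<close> are the functions \<open>\<sigma> :: nat \<Rightarrow> nat\<close> with \<open>\<sigma> permutes {1..n}\<close>, and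
  \<open>X = x ` {1..n}\<close> for an enumeration \<open>x\<close> that is injective on \<open>{1..n}\<close>. The index of an
  element is recovered with \<^const>\<open>inv_into\<close>; see \<open>perm_act_enum\<close> below.
\<close>

definition perm_act :: "nat \<Rightarrow> (nat \<Rightarrow> 'a) \<Rightarrow> (nat \<Rightarrow> nat) \<Rightarrow> 'a \<Rightarrow> 'a" where
  "perm_act n x \<sigma> a = x (\<sigma> (inv_into {1..n} x a))"

lemma perm_act_enum:
  assumes "inj_on x {1..n}" and "i \<in> {1..n}"
  shows "perm_act n x \<sigma> (x i) = x (\<sigma> i)"
  using assms by (simp add: perm_act_def inv_into_f_f)

definition tuple_act :: "nat \<Rightarrow> (nat \<Rightarrow> 'a) \<Rightarrow> (nat \<Rightarrow> nat) \<Rightarrow> 'a list \<Rightarrow> 'a list" where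
  "tuple_act n x \<sigma> = map (perm_act n x \<sigma>)"

text \<open>The set \<open>X\<^sup>m\<close>, with tuples represented as lists; \<open>X\<^sup>0\<close> consists of the empty tuple.\<close>

definition tuples :: "'a set \<Rightarrow> nat \<Rightarrow> 'a list set" where
  "tuples X m = {t. set t \<subseteq> X \<and> length t = m}"

text \<open>Each block is mapped to itself; permuting the blocks among each other is not enough.\<close>

definition preserves_partition ::
    "nat \<Rightarrow> (nat \<Rightarrow> 'a) \<Rightarrow> (nat \<Rightarrow> nat) \<Rightarrow> 'a list set set \<Rightarrow> bool" where
  "preserves_partition n x \<sigma> P \<longleftrightarrow> (\<forall>B\<in>P. tuple_act n x \<sigma> ` B = B)"

end

theory Submission
  imports Defs
begin

text \<open>
  The partition is that of \<open>X\<^sup>n\<^sup>-\<^sup>1\<close> into the orbits of \<open>H\<close>. An element \<open>\<sigma>\<close> preserving every orbit maps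
  \<open>(x\<^sub>1, \<dots>, x\<^sub>n\<^sub>-\<^sub>1)\<close> to its image under some \<open>h \<in> H\<close>, and two permutations agreeing on \<open>n - 1\<close> of
  \<open>n\<close> points are equal, so \<open>\<sigma> = h\<close>.
\<close>

text \<open>The permutation \<open>inv' q \<circ> p\<close> fixes every point of \<open>S\<close>
  other than \<open>a\<close>, so it permutes \<open>{a}\<close>, and a permutation of a single
  point is the identity.\<close>

lemma permutes_eqI_agree_except_one:
  assumes "p permutes S" "q permutes S" and agree: "\<And>i. i \<in> S - {a} \<Longrightarrow> p i = q i"
  shows "p = q"
proof -
  have "inv' q \<circ> p permutes S"
    using assms by (intro permutes_compose permutes_inv)
  moreover have "(inv' q \<circ> p) i = i" if "i \<in> S - {a}" for i
    using agree[OF that] permutes_inverses(2)[OF assms(2)] by simp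
  ultimately have "inv' q \<circ> p permutes {a}"
    by (rule permutes_superset)
  then have "inv' q \<circ> p = id"
    by simp
  then have "q \<circ> (inv' q \<circ> p) = q"
    by simp
  then show ?thesis
    using permutes_inv_o(1)[OF assms(2)] by (simp add: comp_assoc[symmetric])
qed

lemma tuple_act_id:
  assumes "t \<in> tuples (x ` {1..n}) m"
  shows "tuple_act n x id t = t"
proof -
  have "x (inv_into {1..n} x a) = a" if "a \<in> set t" for a
    using assms that unfolding tuples_def by (intro f_inv_into_f) auto
  then show ?thesis
    unfolding tuple_act_def perm_act_def by (simp add: map_idI)
qed

text \<open>After the inner action the index of \<open>x (\<tau> i)\<close> has to be recovered by
  \<open>inv_into\<close>. This returns \<open>\<tau> i\<close> because \<open>x\<close> is
  injective on \<open>{1..n}\<close> and \<open>\<tau>\<close> maps \<open>{1..n}\<close> into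
  itself.\<close>

lemma tuple_act_comp:
  assumes "inj_on x {1..n}" "\<tau> permutes {1..n}" "t \<in> tuples (x ` {1..n}) m"
  shows "tuple_act n x (\<sigma> \<circ> \<tau>) t = tuple_act n x \<sigma> (tuple_act n x \<tau> t)"
proof -
  have "perm_act n x (\<sigma> \<circ> \<tau>) (x i) = perm_act n x \<sigma> (perm_act n x \<tau> (x i))"
    if "i \<in> {1..n}" for i
    using that permutes_in_image[OF assms(2), of i] by (simp only: perm_act_enum[OF assms(1)] comp_apply)
  then show ?thesis
    using assms(3) unfolding tuple_act_def tuples_def by (auto simp del: atLeastAtMost_iff)
qed

lemma tuple_act_in_tuples:
  assumes "inj_on x {1..n}" "\<sigma> permutes {1..n}" "t \<in> tuples (x ` {1..n}) m"
  shows "tuple_act n x \<sigma> t \<in> tuples (x ` {1..n}) m"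
proof -
  have "perm_act n x \<sigma> (x i) \<in> x ` {1..n}" if "i \<in> {1..n}" for i
    using that permutes_in_image[OF assms(2), of i] by (simp only: perm_act_enum[OF assms(1)] imageI)
  then show ?thesis
    using assms(3) unfolding tuple_act_def tuples_def by (auto simp del: atLeastAtMost_iff)
qed

theorem theorem6p8:
  fixes n :: nat and x :: "nat \<Rightarrow> 'a" and X :: "'a set" and H :: "(nat \<Rightarrow> nat) set"
  assumes "n \<ge> 1"
    and "inj_on x {1..n}"
    and "X = x ` {1..n}"
    and "subgroup H (sym_group n)"
  shows "\<exists>P. partition_on (tuples X (n - 1)) P \<and>
    H = {\<sigma> \<in> carrier (sym_group n). preserves_partition n x \<sigma> P}"
proof -
  define T where "T = tuples X (n - 1)"
  \<comment> \<open>The class of \<open>s\<close> under this relation is its orbit. Only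
    \<open>s\<close> is asked to lie in \<open>T\<close>; for \<open>t\<close> this follows from
    \<open>act_T\<close>.\<close>
  define r where "r = {(s, t). s \<in> T \<and> (\<exists>h\<in>H. t = tuple_act n x h s)}"
  have perm: "h permutes {1..n}" if "h \<in> H" for h
    using subgroup.mem_carrier[OF assms(4) that] unfolding sym_group_carrier .
  have id: "id \<in> H"
    using subgroup.one_closed[OF assms(4)] by (simp add: sym_group_one)
  have comp: "g \<circ> h \<in> H" if "g \<in> H" "h \<in> H" for g h
    using subgroup.m_closed[OF assms(4) that] by (simp add: sym_group_mult)
  have inv: "inv' h \<in> H" if "h \<in> H" for h
    using subgroup.m_inv_closed[OF assms(4) that] subgroup.mem_carrier[OF assms(4) that]
    by (simp add: sym_group_inv_equality)
  have act_id: "tuple_act n x id t = t" if "t \<in> T" for t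
    using that tuple_act_id unfolding T_def assms(3) by blast
  have act_comp: "tuple_act n x (g \<circ> h) t = tuple_act n x g (tuple_act n x h t)"
    if "h \<in> H" "t \<in> T" for g h t
    using that tuple_act_comp[OF assms(2) perm] unfolding T_def assms(3) by blast
  have act_T: "tuple_act n x h t \<in> T" if "h \<in> H" "t \<in> T" for h t
    using that tuple_act_in_tuples[OF assms(2) perm] unfolding T_def assms(3) by blast
  have act_inv: "tuple_act n x (inv' h) (tuple_act n x h t) = t"
    "tuple_act n x h (tuple_act n x (inv' h) t) = t" if "h \<in> H" "t \<in> T" for h t
    using that act_comp[of h t "inv' h"] act_comp[of "inv' h" t h] act_id inv
      permutes_inv_o[OF perm[OF that(1)]] by simp_all
  \<comment> \<open>Reflexivity, symmetry and transitivity come from the identity, the inverses and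
    the closure under composition of \<open>H\<close>, respectively.\<close>
  have "equiv T r"
  proof (rule equivI)
    show "r \<subseteq> T \<times> T"
      unfolding r_def using act_T by auto
    show "refl_on T r"
      unfolding r_def using id act_id by (auto intro!: refl_onI bexI[of _ id])
    show "sym r"
    proof (rule symI)
      fix s t
      assume "(s, t) \<in> r"
      then obtain h where h: "s \<in> T" "h \<in> H" "t = tuple_act n x h s"
        unfolding r_def by blast
      then have "s = tuple_act n x (inv' h) t"
        by (simp add: act_inv)
      moreover have "t \<in> T" "inv' h \<in> H"
        using h act_T inv by simp_all
      ultimately show "(t, s) \<in> r"
        unfolding r_def by blast
    qed
    show "trans r"
    proof (rule transI)
      fix s t u
      assume "(s, t) \<in> r" "(t, u) \<in> r"
      then obtain g h where h: "s \<in> T" "h \<in> H" "g \<in> H"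
          "u = tuple_act n x g (tuple_act n x h s)"
        unfolding r_def by blast
      then have "u = tuple_act n x (g \<circ> h) s"
        by (simp add: act_comp)
      then show "(s, u) \<in> r"
        unfolding r_def using h(1) comp[OF h(3,2)] by blast
    qed
  qed
  then have "partition_on T (T // r)"
    by (rule partition_on_quotient)
  moreover have "preserves_partition n x h (T // r)" if "h \<in> H" for h
    unfolding preserves_partition_def
  proof (intro ballI subset_antisym subsetI)
    fix B t
    assume "B \<in> T // r"
    \<comment> \<open>With the block written as the orbit of a representative \<open>s\<close>, both
      inclusions become statements about products in \<open>H\<close>.\<close>
    then obtain s where s: "s \<in> T" and B: "B = (\<lambda>g. tuple_act n x g s) ` H"
      by (auto elim!: quotientE simp: r_def)
    show "t \<in> B" if "t \<in> tuple_act n x h ` B"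
      using that s \<open>h \<in> H\<close> comp unfolding B by (auto simp: act_comp[symmetric])
    assume "t \<in> B"
    then obtain g where g: "g \<in> H" "t = tuple_act n x g s"
      unfolding B by blast
    \<comment> \<open>The preimage of \<open>g s\<close> under \<open>h\<close> is
      \<open>(inv' h \<circ> g) s\<close>, which lies in the same orbit.\<close>
    then have "t = tuple_act n x h (tuple_act n x (inv' h \<circ> g) s)"
      using s \<open>h \<in> H\<close> by (simp add: act_comp act_inv act_T)
    then show "t \<in> tuple_act n x h ` B"
      using comp[OF inv[OF \<open>h \<in> H\<close>] g(1)] unfolding B by blast
  qed
  moreover have "\<sigma> \<in> H" if \<sigma>: "\<sigma> \<in> carrier (sym_group n)" "preserves_partition n x \<sigma> (T // r)" for \<sigma>
  proof -
    \<comment> \<open>The upper bound \<open>n\<close> is excluded, so \<open>t\<close> has length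
      \<open>n - 1\<close> and lists every element of \<open>X\<close> except \<open>x n\<close>.
      For \<open>n = 1\<close> it is the empty tuple.\<close>
    define t where "t = map x [1..<n]"
    have t: "t \<in> T"
      unfolding t_def T_def tuples_def assms(3) by auto
    then have "r `` {t} \<in> T // r" "t \<in> r `` {t}"
      using equiv_class_self[OF \<open>equiv T r\<close>] by (auto intro: quotientI)
    \<comment> \<open>Here it matters that each block is mapped to itself: if
      \<open>\<sigma>\<close> only permuted the blocks, the image of \<open>t\<close> could lie in
      another orbit.\<close>
    moreover from this(1) have "tuple_act n x \<sigma> ` (r `` {t}) = r `` {t}"
      using \<sigma>(2) unfolding preserves_partition_def by (rule bspec[rotated])
    ultimately have "tuple_act n x \<sigma> t \<in> r `` {t}"
      by (metis imageI)
    then have "(t, tuple_act n x \<sigma> t) \<in> r"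
      by simp
    then obtain h where h: "h \<in> H" "tuple_act n x \<sigma> t = tuple_act n x h t"
      unfolding r_def by blast
    have \<sigma>_perm: "\<sigma> permutes {1..n}"
      using \<sigma>(1) unfolding sym_group_carrier .
    \<comment> \<open>The tuple \<open>t\<close> shows the values of \<open>\<sigma>\<close> at all
      indices but \<open>n\<close>, so \<open>n\<close> is the exceptional point \<open>a\<close> of
      \<open>permutes_eqI_agree_except_one\<close>.\<close>
    have "\<sigma> i = h i" if i: "i \<in> {1..n} - {n}" for i
    proof -
      have "x i \<in> set t"
        using i by (auto simp: t_def)
      then have "perm_act n x \<sigma> (x i) = perm_act n x h (x i)"
        using h(2) by (auto simp: tuple_act_def)
      then have "x (\<sigma> i) = x (h i)"
        using i by (simp add: perm_act_enum[OF assms(2)])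
      \<comment> \<open>Since \<open>x\<close> is injective only on \<open>{1..n}\<close>, both
        indices must be known to lie there before \<open>x\<close> can be cancelled.\<close>
      moreover have "\<sigma> i \<in> {1..n}" "h i \<in> {1..n}"
        using i permutes_in_image[OF \<sigma>_perm] permutes_in_image[OF perm[OF h(1)]] by blast+
      ultimately show ?thesis
        using assms(2) by (blast dest: inj_onD)
    qed
    then have "\<sigma> = h"
      by (rule permutes_eqI_agree_except_one[OF \<sigma>_perm perm[OF h(1)]])
    then show ?thesis
      using h(1) by simp
  qed
  ultimately show ?thesis
    using subgroup.subset[OF assms(4)] unfolding T_def by (intro exI[of _ "tuples X (n - 1) // r"]) auto
qed

end
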